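(* Let $p$ be an odd prime, $s\ge 2$ and $m\ge 1$ integers, $R$ the Galois ring of characteristic $p^{s}$ and cardinality $p^{sm}$, and $\delta\in\{0,1,2\}$. Then the orthogonal graph $\Gamma^{2+\delta}$ (the case $\nu=1$) is strongly regular with parameters $(n,k,\lambda,\mu)$, where $$n=\frac{(p^{m}-1)(p^{m\delta}+1)p^{m(s-1)\delta}}{p^{m}-1}=(p^{m\delta}+1)p^{m(s-1)\delta},\qquad k=p^{ms\delta},$$ $\lambda=(p^{m\delta}-1)p^{m\delta(s-1)}$ and $\mu=\lceil\delta/2\rceil p^{ms\delta}$.
   Context: $R$ is a finite local ring with maximal ideal $pR$ and residue field of order $p^{m}$; $R^{*}$ is its unit group and $z$ a fixed non-square element of $R^{*}$. For $\nu\ge1$, vectors of length $2\nu+\delta$ over $R$ having some unit coordinate are considered up to multiplication by units; $[a_1,\dots,a_{2\nu+\delta}]$ denotes the class. Let $S=\begin{pmatrix}0&I^{(\nu)}&0\\ I^{(\nu)}&0&0\\0&0&\Delta\end{pmatrix}$ with $\Delta$ absent if $\delta=0$, $\Delta=(1)$ or $(z)$ (one fixed choice) if $\delta=1$, $\Delta=\mathrm{diag}(1,-z)$ if $\delta=2$. The orthogonal graph $\Gamma^{2\nu+\delta}$ has vertices the classes $[\alpha]$ with $\alpha S\alpha^{t}=0$, and $[\alpha]\sim[\beta]$ iff $\alpha S\beta^{t}\in R^{*}$. A strongly regular graph with parameters $(n,k,\lambda,\mu)$ is a $k$-regular graph on $n$ vertices in which adjacent vertices have exactly $\lambda$ common neighbours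 and distinct non-adjacent vertices have exactly $\mu$ common neighbours. The paper's standing assumption is $s\ge2$. *)

theory Defs
  imports
    "Jordan_Normal_Form.VS_Connect"
    "Graph_Theory.Pair_Digraph"
    "HOL-Algebra.Ideal"
    "HOL-Library.Cardinality"
    "HOL-Computational_Algebra.Primes"
begin

text \<open>A finite commutative local ring with maximal ideal \<open>pR\<close>, i.e. a Galois ring. Together with
  its characteristic \<open>p ^ s\<close> and its cardinality \<open>p ^ (s * m)\<close> this determines the ring up to
  isomorphism. The residue field then has order \<open>p ^ m\<close>.\<close>

definition galois_ring :: "'a :: {comm_ring_1, finite} itself \<Rightarrow> nat \<Rightarrow> nat \<Rightarrow> nat \<Rightarrow> bool" where
  "galois_ring _ p s m \<longleftrightarrow>
     (\<forall>J. maximalideal J (class_ring :: 'a ring) \<longleftrightarrow>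
          J = PIdl\<^bsub>class_ring :: 'a ring\<^esub> (of_nat p)) \<and>
     CHAR('a) = p ^ s \<and> CARD('a) = p ^ (s * m)"

text \<open>The parameter \<open>c\<close> is the entry of \<open>\<Delta>\<close> for \<open>\<delta> = 1\<close>; it is to be \<open>1\<close> or \<open>z\<close>. The value
  for \<open>\<delta> > 2\<close> is irrelevant.\<close>

definition Delta_mat :: "'a :: comm_ring_1 \<Rightarrow> 'a \<Rightarrow> nat \<Rightarrow> 'a mat" where
  "Delta_mat z c \<delta> =
     (if \<delta> = 0 then mk_diagonal [] else if \<delta> = 1 then mk_diagonal [c] else mk_diagonal [1, - z])"

definition orth_mat :: "'a :: comm_ring_1 \<Rightarrow> 'a \<Rightarrow> nat \<Rightarrow> nat \<Rightarrow> 'a mat" where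
  "orth_mat z c \<nu> \<delta> =
     four_block_mat
       (four_block_mat (0\<^sub>m \<nu> \<nu>) (1\<^sub>m \<nu>) (1\<^sub>m \<nu>) (0\<^sub>m \<nu> \<nu>)) (0\<^sub>m (2 * \<nu>) \<delta>)
       (0\<^sub>m \<delta> (2 * \<nu>)) (Delta_mat z c \<delta>)"

definition orth_form :: "'a :: comm_ring_1 \<Rightarrow> 'a \<Rightarrow> nat \<Rightarrow> nat \<Rightarrow> 'a vec \<Rightarrow> 'a vec \<Rightarrow> 'a" where
  "orth_form z c \<nu> \<delta> \<alpha> \<beta> = \<alpha> \<bullet> (orth_mat z c \<nu> \<delta> *\<^sub>v \<beta>)"

definition unit_coord_vecs :: "nat \<Rightarrow> 'a :: comm_ring_1 vec set" where
  "unit_coord_vecs n = {\<alpha> \<in> carrier_vec n. \<exists>i<n. \<alpha> $ i dvd 1}"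

definition vec_class :: "'a :: comm_ring_1 vec \<Rightarrow> 'a vec set" where
  "vec_class \<alpha> = {u \<cdot>\<^sub>v \<alpha> | u. u dvd 1}"

definition orth_verts :: "'a :: comm_ring_1 \<Rightarrow> 'a \<Rightarrow> nat \<Rightarrow> nat \<Rightarrow> 'a vec set set" where
  "orth_verts z c \<nu> \<delta> =
     {vec_class \<alpha> | \<alpha>. \<alpha> \<in> unit_coord_vecs (2 * \<nu> + \<delta>) \<and> orth_form z c \<nu> \<delta> \<alpha> \<alpha> = 0}"

definition orth_graph :: "'a :: comm_ring_1 \<Rightarrow> 'a \<Rightarrow> nat \<Rightarrow> nat \<Rightarrow> 'a vec set pair_pre_digraph" where
  "orth_graph z c \<nu> \<delta> =
     \<lparr>pverts = orth_verts z c \<nu> \<delta>,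
      parcs = {(A, B). A \<in> orth_verts z c \<nu> \<delta> \<and> B \<in> orth_verts z c \<nu> \<delta> \<and>
                       (\<exists>\<alpha>\<in>A. \<exists>\<beta>\<in>B. orth_form z c \<nu> \<delta> \<alpha> \<beta> dvd 1)}\<rparr>"

text \<open>The matrix has the intended dimensions, two vectors have the same class iff they
  differ by a unit factor, and adjacency does not depend on the chosen representatives.\<close>

lemma orth_mat_carrier:
  fixes z c :: "'a :: comm_ring_1"
  assumes "\<delta> \<in> {0, 1, 2}"
  shows "orth_mat z c \<nu> \<delta> \<in> carrier_mat (2 * \<nu> + \<delta>) (2 * \<nu> + \<delta>)"
proof -
  have "Delta_mat z c \<delta> \<in> carrier_mat \<delta> \<delta>"
    using assms by (auto simp: Delta_mat_def mk_diagonal_dim intro!: carrier_matI)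
  moreover have "four_block_mat (0\<^sub>m \<nu> \<nu>) (1\<^sub>m \<nu>) (1\<^sub>m \<nu>) (0\<^sub>m \<nu> \<nu> :: 'a mat)
      \<in> carrier_mat (2 * \<nu>) (2 * \<nu>)"
    unfolding mult_2 by (rule four_block_carrier_mat) simp_all
  ultimately show ?thesis
    unfolding orth_mat_def by (intro four_block_carrier_mat)
qed

lemma vec_class_eq_iff:
  "vec_class \<alpha> = vec_class \<beta> \<longleftrightarrow> (\<exists>u. u dvd 1 \<and> \<beta> = u \<cdot>\<^sub>v \<alpha>)"
proof
  assume eq: "vec_class \<alpha> = vec_class \<beta>"
  have "\<beta> \<in> vec_class \<beta>" unfolding vec_class_def by (intro CollectI exI[of _ 1]) auto
  then show "\<exists>u. u dvd 1 \<and> \<beta> = u \<cdot>\<^sub>v \<alpha>" unfolding eq[symmetric] by (auto simp: vec_class_def)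
next
  assume "\<exists>u. u dvd 1 \<and> \<beta> = u \<cdot>\<^sub>v \<alpha>"
  then obtain u v where uv: "u dvd 1" "\<beta> = u \<cdot>\<^sub>v \<alpha>" "u * v = 1" by (metis dvdE)
  have v: "v dvd 1" using uv(3) by (metis dvd_triv_right)
  show "vec_class \<alpha> = vec_class \<beta>"
  proof (intro equalityI subsetI)
    fix x assume "x \<in> vec_class \<alpha>"
    then obtain w where w: "w dvd 1" "x = w \<cdot>\<^sub>v \<alpha>" by (auto simp: vec_class_def)
    have "w * v * u = w" using uv(3) by (metis mult.assoc mult.commute mult.right_neutral)
    then have "x = (w * v) \<cdot>\<^sub>v \<beta>" using w uv by (simp add: smult_smult_assoc)
    moreover have "w * v dvd 1" using w(1) v by (metis mult_dvd_mono mult_1)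
    ultimately show "x \<in> vec_class \<beta>" by (auto simp: vec_class_def)
  next
    fix x assume "x \<in> vec_class \<beta>"
    then obtain w where w: "w dvd 1" "x = w \<cdot>\<^sub>v \<beta>" by (auto simp: vec_class_def)
    have "x = (w * u) \<cdot>\<^sub>v \<alpha>" using w uv by (simp add: smult_smult_assoc)
    moreover have "w * u dvd 1" using w(1) uv(1) by (metis mult_dvd_mono mult_1)
    ultimately show "x \<in> vec_class \<alpha>"
      by (auto simp: vec_class_def)
  qed
qed

lemma orth_graph_adj_iff:
  fixes z c :: "'a :: comm_ring_1"
  assumes "\<delta> \<in> {0, 1, 2}"
    and "\<alpha> \<in> unit_coord_vecs (2 * \<nu> + \<delta>)" "orth_form z c \<nu> \<delta> \<alpha> \<alpha> = 0"
    and "\<beta> \<in> unit_coord_vecs (2 * \<nu> + \<delta>)" "orth_form z c \<nu> \<delta> \<beta> \<beta> = 0"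
  shows "(vec_class \<alpha>, vec_class \<beta>) \<in> parcs (orth_graph z c \<nu> \<delta>) \<longleftrightarrow>
           orth_form z c \<nu> \<delta> \<alpha> \<beta> dvd 1"
proof -
  note S = orth_mat_carrier[OF assms(1), of z c \<nu>]
  have ab: "\<alpha> \<in> carrier_vec (2 * \<nu> + \<delta>)" "\<beta> \<in> carrier_vec (2 * \<nu> + \<delta>)"
    using assms by (auto simp: unit_coord_vecs_def)
  have sc: "orth_form z c \<nu> \<delta> (u \<cdot>\<^sub>v \<alpha>) (v \<cdot>\<^sub>v \<beta>) = u * v * orth_form z c \<nu> \<delta> \<alpha> \<beta>" for u v
  proof -
    have "orth_mat z c \<nu> \<delta> *\<^sub>v (v \<cdot>\<^sub>v \<beta>) = v \<cdot>\<^sub>v (orth_mat z c \<nu> \<delta> *\<^sub>v \<beta>)"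
      using S ab by (intro eq_vecI) (auto simp: scalar_prod_def sum_distrib_left ac_simps)
    then show ?thesis
      using S ab by (auto simp: orth_form_def scalar_prod_def sum_distrib_left ac_simps)
  qed
  have V: "vec_class \<alpha> \<in> orth_verts z c \<nu> \<delta>" "vec_class \<beta> \<in> orth_verts z c \<nu> \<delta>"
    using assms by (auto simp: orth_verts_def)
  have ex: "(\<exists>x\<in>vec_class \<gamma>. P x) \<longleftrightarrow> (\<exists>u. u dvd 1 \<and> P (u \<cdot>\<^sub>v \<gamma>))" for P and \<gamma> :: "'a vec"
    by (auto simp: vec_class_def)
  have "(\<exists>x\<in>vec_class \<alpha>. \<exists>y\<in>vec_class \<beta>. orth_form z c \<nu> \<delta> x y dvd 1) \<longleftrightarrow>
          (\<exists>u v. u dvd 1 \<and> v dvd 1 \<and> u * v * orth_form z c \<nu> \<delta> \<alpha> \<beta> dvd 1)"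
    unfolding ex sc by simp
  also have "\<dots> \<longleftrightarrow> orth_form z c \<nu> \<delta> \<alpha> \<beta> dvd 1"
  proof
    assume "\<exists>u v. u dvd 1 \<and> v dvd 1 \<and> u * v * orth_form z c \<nu> \<delta> \<alpha> \<beta> dvd 1"
    then show "orth_form z c \<nu> \<delta> \<alpha> \<beta> dvd 1" by (elim exE conjE) (rule dvd_mult_right)
  next
    assume "orth_form z c \<nu> \<delta> \<alpha> \<beta> dvd 1"
    then show "\<exists>u v. u dvd 1 \<and> v dvd 1 \<and> u * v * orth_form z c \<nu> \<delta> \<alpha> \<beta> dvd 1"
      by (intro exI[of _ 1]) simp
  qed
  finally show ?thesis using V by (simp add: orth_graph_def)
qed

text \<open>The locale \<open>pair_graph\<close> consists of the finite, symmetric, loop-free digraphs without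
  multiple arcs, i.e. the finite simple graphs.\<close>

definition common_neighbours :: "'v pair_pre_digraph \<Rightarrow> 'v \<Rightarrow> 'v \<Rightarrow> 'v set" where
  "common_neighbours G x y = {w \<in> pverts G. (x, w) \<in> parcs G \<and> (y, w) \<in> parcs G}"

definition strongly_regular ::
  "'v pair_pre_digraph \<Rightarrow> nat \<Rightarrow> nat \<Rightarrow> nat \<Rightarrow> nat \<Rightarrow> bool" where
  "strongly_regular G n k l \<mu> \<longleftrightarrow>
     pair_graph G \<and> card (pverts G) = n \<and>
     (\<forall>x \<in> pverts G. card {w \<in> pverts G. (x, w) \<in> parcs G} = k) \<and>
     (\<forall>x \<in> pverts G. \<forall>y \<in> pverts G. (x, y) \<in> parcs G \<longrightarrow>
        card (common_neighbours G x y) = l) \<and>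
     (\<forall>x \<in> pverts G. \<forall>y \<in> pverts G. x \<noteq> y \<and> (x, y) \<notin> parcs G \<longrightarrow>
        card (common_neighbours G x y) = \<mu>)"

end

theory Submission
  imports Defs "HOL-Library.Product_Plus"
begin

text \<open>Scale an isotropic vector \<open>(a, b, x)\<close> so that \<open>a = 1\<close> if \<open>a\<close> is a unit, and \<open>b = 1\<close>
  otherwise. The other coordinate of the hyperbolic pair is then \<open>- q(x) / 2\<close>, where \<open>q\<close> is the
  form of \<open>\<Delta>\<close>. As \<open>q\<close> is anisotropic modulo \<open>p\<close>, the entries of \<open>x\<close> lie in \<open>pR\<close> in the
  second case. Two vectors of the same kind pair to \<open>- q(x - y) / 2\<close>, and two of different kinds
  pair to \<open>1\<close> modulo \<open>p\<close>. So the graph is complete multipartite: its parts are the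
  \<open>p ^ (m * \<delta>)\<close> cosets of \<open>(pR) ^ \<delta>\<close> in the first family, and the second family.\<close>

section \<open>Complete multipartite graphs with parts of equal size\<close>

text \<open>The neighbours of a vertex are the vertices outside its part. Adjacent vertices lie in
  two disjoint parts, so their common neighbours avoid \<open>2 * t\<close> vertices; non-adjacent
  vertices share a part and have the same neighbours. For \<open>t = 1\<close> there are no two
  distinct non-adjacent vertices, so any \<open>\<mu>\<close> is correct; the case
  \<open>\<delta> = 0\<close> falls under this alternative.\<close>

lemma strongly_regular_complete_multipartite:
  assumes fin: "finite (pverts G)" and sub: "parcs G \<subseteq> pverts G \<times> pverts G"
    and eq: "equiv (pverts G) (pverts G \<times> pverts G - parcs G)"
    and part: "\<And>x. x \<in> pverts G \<Longrightarrow> card {y \<in> pverts G. (x, y) \<notin> parcs G} = t"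
    and n: "card (pverts G) = n" and \<mu>: "t = 1 \<or> \<mu> = n - t"
  shows "strongly_regular G n (n - t) (n - 2 * t) \<mu>"
proof -
  let ?V = "pverts G" and ?E = "parcs G"
  define C where "C x = {y \<in> ?V. (x, y) \<notin> ?E}" for x
  have C: "finite (C x)" "C x \<subseteq> ?V" for x using fin by (auto simp: C_def)
  have refl: "(x, x) \<notin> ?E" if "x \<in> ?V" for x
    using eq that by (auto simp: equiv_def refl_on_def)
  have sym: "(y, x) \<in> ?E" if "(x, y) \<in> ?E" for x y
    using eq that sub by (auto simp: equiv_def sym_def)
  have trans: "(x, z) \<notin> ?E" if "(x, y) \<notin> ?E" "(y, z) \<notin> ?E" "x \<in> ?V" "y \<in> ?V" "z \<in> ?V" for x y z
    using eq that by (auto simp: equiv_def trans_def)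
  have "finite ?E" using fin sub finite_subset by blast
  then have graph: "pair_graph G"
    using fin sub sym refl
    by unfold_locales (auto simp: symmetric_def arcs_ends_conv intro!: symI)
  have nb: "{w \<in> ?V. (x, w) \<in> ?E} = ?V - C x" for x by (auto simp: C_def)
  have k: "card {w \<in> ?V. (x, w) \<in> ?E} = n - t" if "x \<in> ?V" for x
    unfolding nb using part[OF that] C n by (simp add: card_Diff_subset C_def)
  have l: "card (common_neighbours G x y) = n - 2 * t"
    if "x \<in> ?V" "y \<in> ?V" "(x, y) \<in> ?E" for x y
  proof -
    have "w \<notin> C y" if "w \<in> C x" for w
      using that \<open>x \<in> ?V\<close> \<open>y \<in> ?V\<close> \<open>(x, y) \<in> ?E\<close> trans[of x w y] sym[of w y] by (auto simp: C_def)
    then have "C x \<inter> C y = {}" by blast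
    then have "card (C x \<union> C y) = 2 * t"
      using C part that by (subst card_Un_disjoint) (auto simp: C_def)
    moreover have "common_neighbours G x y = ?V - (C x \<union> C y)"
      by (auto simp: common_neighbours_def C_def)
    ultimately show ?thesis
      using C n by (simp add: card_Diff_subset)
  qed
  have m: "card (common_neighbours G x y) = \<mu>"
    if "x \<in> ?V" "y \<in> ?V" "x \<noteq> y" "(x, y) \<notin> ?E" for x y
  proof -
    \<comment> \<open>The part of \<open>x\<close> contains two distinct vertices, which leaves only
      the alternative \<open>\<mu> = n - t\<close>.\<close>
    have "{x, y} \<subseteq> C x" using that refl by (auto simp: C_def)
    then have "card {x, y} \<le> card (C x)" using C card_mono by blast
    then have "t \<noteq> 1" using that part[of x] by (auto simp: C_def)
    moreover have "(y, w) \<in> ?E" if "w \<in> ?V" "(x, w) \<in> ?E" for w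
      using that \<open>x \<in> ?V\<close> \<open>y \<in> ?V\<close> \<open>(x, y) \<notin> ?E\<close> trans[of x y w] by auto
    then have "common_neighbours G x y = {w \<in> ?V. (x, w) \<in> ?E}"
      unfolding common_neighbours_def by blast
    ultimately show ?thesis using k that \<mu> by simp
  qed
  show ?thesis
    unfolding strongly_regular_def using graph n k l m by blast
qed

section \<open>Units, ideals and cardinalities in the Galois ring\<close>

text \<open>The principal ideal of a non-unit is proper, and by finiteness the proper ideals that
  contain \<open>x\<close> have a maximal member.\<close>

lemma finite_ring_nonunit_in_maximalideal:
  fixes x :: "'a :: {comm_ring_1, finite}"
  assumes "\<not> x dvd 1"
  shows "\<exists>J. maximalideal J (class_ring :: 'a ring) \<and> x \<in> J"
proof -
  let ?R = "class_ring :: 'a ring"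
  define \<I> where "\<I> = {J. ideal J ?R \<and> x \<in> J \<and> J \<noteq> UNIV}"
  have fin: "finite \<I>" by (rule finite)
  have "PIdl\<^bsub>?R\<^esub> x \<in> \<I>"
  proof -
    have "1 \<notin> PIdl\<^bsub>?R\<^esub> x" using assms by (auto simp: cgenideal_def dvd_def mult.commute)
    moreover have "x \<in> PIdl\<^bsub>?R\<^esub> x" by (auto simp: cgenideal_def intro: exI[of _ 1])
    moreover have "ideal (PIdl\<^bsub>?R\<^esub> x) ?R" by (rule cring.cgenideal_ideal[OF class_cring.cring_axioms]) simp
    ultimately show ?thesis unfolding \<I>_def by blast
  qed
  then obtain J where J: "J \<in> \<I>" "\<And>K. K \<in> \<I> \<Longrightarrow> J \<subseteq> K \<Longrightarrow> J = K"
    using finite_has_maximal[OF fin] by auto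
  have "maximalideal J ?R"
    using J by (intro maximalidealI) (auto simp: \<I>_def)
  then show ?thesis using J by (auto simp: \<I>_def)
qed

locale odd_galois_ring =
  fixes p s m :: nat and \<pi> :: "'a :: {comm_ring_1, finite}"
  assumes prime_p: "prime p" and odd_p: "odd p" and s_pos: "s \<ge> 1"
    and galois: "galois_ring TYPE('a) p s m"
    and \<pi>_def: "\<pi> = of_nat p"
begin

lemma \<pi>_power_eq_0_iff: "\<pi> ^ i = 0 \<longleftrightarrow> s \<le> i"
proof -
  have "\<pi> ^ i = of_nat (p ^ i)" by (simp add: \<pi>_def)
  also have "\<dots> = 0 \<longleftrightarrow> p ^ s dvd p ^ i"
    using galois by (simp only: of_nat_eq_0_iff_char_dvd galois_ring_def)
  also have "\<dots> \<longleftrightarrow> s \<le> i"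
    using prime_gt_1_nat[OF prime_p] by (simp add: dvd_power_iff_le)
  finally show ?thesis .
qed

text \<open>A non-unit lies in some maximal ideal, and the only one is generated by
  \<open>\<pi>\<close>. Conversely \<open>\<pi>\<close> is nilpotent in a nonzero ring, so no
  multiple of it is a unit.\<close>

lemma not_unit_iff: "\<not> x dvd 1 \<longleftrightarrow> \<pi> dvd x"
proof
  assume "\<not> x dvd 1"
  then obtain J where "maximalideal J (class_ring :: 'a ring)" "x \<in> J"
    using finite_ring_nonunit_in_maximalideal by blast
  then have "x \<in> PIdl\<^bsub>class_ring :: 'a ring\<^esub> \<pi>"
    using galois by (simp add: galois_ring_def \<pi>_def)
  then show "\<pi> dvd x" by (auto simp: cgenideal_def)
next
  assume "\<pi> dvd x"
  show "\<not> x dvd 1"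
  proof
    assume "x dvd 1"
    with \<open>\<pi> dvd x\<close> have "\<pi> dvd 1" by (rule dvd_trans)
    then have "\<pi> ^ s dvd 1" by (metis dvd_power_same power_one)
    then show False using \<pi>_power_eq_0_iff[of s] by simp
  qed
qed

lemma unit_iff: "x dvd 1 \<longleftrightarrow> \<not> \<pi> dvd x"
  using not_unit_iff by blast

lemma \<pi>_dvd_mult_iff: "\<pi> dvd x * y \<longleftrightarrow> \<pi> dvd x \<or> \<pi> dvd y"
  by (metis dvd_mult dvd_mult2 is_unit_mult_iff not_unit_iff)

lemma unit_two: "(2 :: 'a) dvd 1"
proof (rule ccontr)
  assume "\<not> 2 dvd (1 :: 'a)"
  then have "\<pi> dvd 2" by (simp add: not_unit_iff)
  moreover obtain k where "p = 2 * k + 1" using odd_p by (elim oddE)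
  then have "\<pi> = 2 * of_nat k + 1" by (simp add: \<pi>_def)
  ultimately have "\<pi> dvd 1" by (metis dvd_add_right_iff dvd_mult2 dvd_refl)
  then show False using unit_iff[of \<pi>] by simp
qed

text \<open>For \<open>w \<noteq> 0\<close> take the largest \<open>i\<close> with
  \<open>w = \<pi> ^ i * u\<close>. By maximality \<open>u\<close> is a unit, so
  \<open>\<pi> * w = 0\<close> gives \<open>\<pi> ^ Suc i = 0\<close> and hence
  \<open>s \<le> Suc i\<close>.\<close>

lemma annihilator_\<pi>: "\<pi> * w = 0 \<longleftrightarrow> \<pi> ^ (s - 1) dvd w"
proof
  assume w: "\<pi> * w = 0"
  show "\<pi> ^ (s - 1) dvd w"
  proof (cases "w = 0")
    case False
    define i where "i = (GREATEST i. \<pi> ^ i dvd w)"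
    have bound: "j \<le> s" if "\<pi> ^ j dvd w" for j
      using that False \<pi>_power_eq_0_iff[of j] by (metis dvd_0_left nat_le_linear)
    have i: "\<pi> ^ i dvd w"
      unfolding i_def
      by (rule GreatestI_nat[where P = "\<lambda>i. \<pi> ^ i dvd w" and k = 0 and b = s]) (simp_all add: bound)
    then obtain u where u: "w = \<pi> ^ i * u" by (elim dvdE)
    have "\<not> \<pi> dvd u"
    proof
      assume "\<pi> dvd u"
      then have "\<pi> ^ Suc i dvd w" unfolding u by (simp add: mult_dvd_mono mult.commute)
      then have "Suc i \<le> i"
        unfolding i_def using bound by (rule Greatest_le_nat[where P = "\<lambda>i. \<pi> ^ i dvd w"])
      then show False by simp
    qed
    then obtain v where v: "u * v = 1" using unit_iff[of u] by (metis dvdE)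
    have "\<pi> ^ Suc i = \<pi> * w * v" using u v by (simp add: mult.assoc)
    then have "s \<le> Suc i" using w \<pi>_power_eq_0_iff[of "Suc i"] by simp
    then have "\<pi> ^ (s - 1) dvd \<pi> ^ i" by (intro le_imp_power_dvd) simp
    then show ?thesis using i dvd_trans by blast
  qed simp
next
  assume "\<pi> ^ (s - 1) dvd w"
  then obtain v where "w = \<pi> ^ (s - 1) * v" by (elim dvdE)
  then have "\<pi> * w = \<pi> ^ Suc (s - 1) * v" by (simp add: mult.assoc)
  then show "\<pi> * w = 0" using s_pos \<pi>_power_eq_0_iff[of "Suc (s - 1)"] by simp
qed

text \<open>Multiplication by \<open>\<pi>\<close> maps the multiples of \<open>\<pi> ^ i\<close>
  onto those of \<open>\<pi> ^ Suc i\<close>. Each fibre is a coset of the annihilator of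
  \<open>\<pi>\<close>, which consists of multiples of \<open>\<pi> ^ i\<close> because
  \<open>i \<le> s - 1\<close>.\<close>

lemma card_multiples_power_Suc:
  assumes "i < s"
  shows "card {x :: 'a. \<pi> ^ i dvd x}
    = card {x :: 'a. \<pi> ^ Suc i dvd x} * card {x :: 'a. \<pi> ^ (s - 1) dvd x}"
proof -
  let ?A = "{x :: 'a. \<pi> ^ i dvd x}" and ?N = "{x :: 'a. \<pi> ^ (s - 1) dvd x}"
  have im: "(*) \<pi> ` ?A = {x. \<pi> ^ Suc i dvd x}"
  proof (intro equalityI subsetI)
    fix x assume "x \<in> {x. \<pi> ^ Suc i dvd x}"
    then obtain k where "x = \<pi> * (\<pi> ^ i * k)" by (auto simp: dvd_def mult.assoc)
    then show "x \<in> (*) \<pi> ` ?A" by (intro image_eqI) auto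
  qed (auto intro: mult_dvd_mono)
  have fib: "card {x. x \<in> ?A \<and> \<pi> * x = y} = card ?N" if y: "y \<in> (*) \<pi> ` ?A" for y
  proof -
    obtain a where a: "\<pi> ^ i dvd a" "y = \<pi> * a" using y by auto
    have "\<pi> ^ i dvd \<pi> ^ (s - 1)" using assms by (intro le_imp_power_dvd) simp
    then have "{x. x \<in> ?A \<and> \<pi> * x = y} = (+) a ` ?N"
    proof (intro equalityI subsetI)
      fix x assume "x \<in> {x. x \<in> ?A \<and> \<pi> * x = y}"
      then have "\<pi> * (x - a) = 0" using a by (simp add: algebra_simps)
      then have "x - a \<in> ?N" by (simp add: annihilator_\<pi>)
      then show "x \<in> (+) a ` ?N" by (intro image_eqI[of _ _ "x - a"]) auto
    next
      fix x assume "x \<in> (+) a ` ?N"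
      then obtain w where w: "x = a + w" "\<pi> ^ (s - 1) dvd w" by auto
      then have "\<pi> * w = 0" by (simp add: annihilator_\<pi>)
      then show "x \<in> {x. x \<in> ?A \<and> \<pi> * x = y}"
        using w a \<open>\<pi> ^ i dvd \<pi> ^ (s - 1)\<close> dvd_trans by (auto simp: distrib_left)
    qed
    then show ?thesis by (simp add: card_image)
  qed
  have "card ?A = (\<Sum>x\<in>?A. 1)" by simp
  also have "\<dots> = (\<Sum>y\<in>(*) \<pi> ` ?A. \<Sum>x\<in>{x. x \<in> ?A \<and> \<pi> * x = y}. 1)"
    by (rule sum.image_gen) simp
  also have "\<dots> = (\<Sum>y\<in>(*) \<pi> ` ?A. card ?N)" using fib by (intro sum.cong) auto
  finally show ?thesis by (simp add: im)
qed

text \<open>Let \<open>t\<close> be the order of the annihilator of \<open>\<pi>\<close>. Starting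
  from the zero ideal at exponent \<open>s\<close>, every decrease of the exponent multiplies the
  cardinality by \<open>t\<close>. At exponent 0 this is the whole ring, so
  \<open>t ^ s = (p ^ m) ^ s\<close> determines \<open>t\<close>; the claim is the case of exponent
  1.\<close>

lemma card_multiples: "card {x :: 'a. \<pi> dvd x} = p ^ (m * (s - 1))"
proof -
  define t where "t = card {x :: 'a. \<pi> ^ (s - 1) dvd x}"
  have *: "card {x :: 'a. \<pi> ^ (s - j) dvd x} = t ^ j" if "j \<le> s" for j
    using that
  proof (induction j)
    case 0
    then show ?case using \<pi>_power_eq_0_iff[of s] by simp
  next
    case (Suc j)
    then have "Suc (s - Suc j) = s - j" by simp
    then show ?case
      using card_multiples_power_Suc[of "s - Suc j"] Suc by (simp add: t_def mult.commute)
  qed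
  from *[of s] have "t ^ s = CARD('a)" by simp
  also have "\<dots> = (p ^ m) ^ s"
    using galois by (simp add: galois_ring_def power_mult[symmetric] mult.commute)
  finally have "t = p ^ m" by (rule power_eq_imp_eq_base) (use s_pos in auto)
  then show ?thesis using *[of "s - 1"] s_pos by (simp add: power_mult)
qed

section \<open>Lifting squares from the residue field\<close>

text \<open>Finiteness replaces Hensel's lemma: squaring maps the elements congruent to 1 into
  themselves, and it is injective there because \<open>x + y\<close> is congruent to 2, a unit, in
  \<open>(x - y) * (x + y) = 0\<close>. Hence it is surjective.\<close>

lemma one_plus_multiple_is_square:
  assumes "\<pi> dvd w - 1"
  shows "\<exists>y. w = y\<^sup>2"
proof -
  let ?A = "{x :: 'a. \<pi> dvd x - 1}"
  have "inj_on (\<lambda>x. x\<^sup>2) ?A"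
  proof
    fix x y assume xy: "x \<in> ?A" "y \<in> ?A" "x\<^sup>2 = y\<^sup>2"
    have "\<not> \<pi> dvd x + y"
    proof
      assume "\<pi> dvd x + y"
      moreover have "\<pi> dvd (x - 1) + (y - 1)" using xy by (intro dvd_add) auto
      ultimately have "\<pi> dvd (x + y) - ((x - 1) + (y - 1))" by (rule dvd_diff)
      then show False using unit_two by (simp add: unit_iff)
    qed
    then obtain v where v: "(x + y) * v = 1" using unit_iff dvdE by metis
    have "(x - y) * (x + y) = 0" using xy by (simp add: algebra_simps power2_eq_square)
    then have "(x - y) * ((x + y) * v) = 0" by (simp add: mult.assoc[symmetric])
    then show "x = y" by (simp add: v)
  qed
  moreover have "(\<lambda>x. x\<^sup>2) ` ?A \<subseteq> ?A"
  proof safe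
    fix x assume "\<pi> dvd x - 1"
    then have "\<pi> dvd (x - 1) * (x + 1)" by (rule dvd_mult2)
    then show "\<pi> dvd x\<^sup>2 - 1" by (simp add: algebra_simps power2_eq_square)
  qed
  ultimately have "(\<lambda>x. x\<^sup>2) ` ?A = ?A" by (intro endo_inj_surj) auto
  then show ?thesis using assms by blast
qed

text \<open>As \<open>z\<close> is a unit, so is \<open>y\<close>; with its inverse \<open>v\<close>
  the element \<open>z * v\<^sup>2\<close> is congruent to 1, hence a square. Consequently a
  non-square unit remains a non-square modulo \<open>\<pi>\<close>.\<close>

lemma square_of_square_mod:
  assumes "z dvd 1" "\<pi> dvd y\<^sup>2 - z"
  shows "\<exists>y. z = y\<^sup>2"
proof -
  have "\<not> \<pi> dvd y"
  proof
    assume "\<pi> dvd y"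
    then have "\<pi> dvd y\<^sup>2" by (simp add: power2_eq_square)
    then have "\<pi> dvd z" using assms(2) by (metis dvd_diff diff_diff_eq2 add_diff_cancel_left')
    then show False using assms unit_iff[of z] by simp
  qed
  then obtain v where v: "y * v = 1" using unit_iff dvdE by metis
  have v2: "y\<^sup>2 * v\<^sup>2 = 1" using v by (simp add: power_mult_distrib[symmetric])
  have "\<pi> dvd (y\<^sup>2 - z) * - (v\<^sup>2)" using assms(2) by (rule dvd_mult2)
  also have "(y\<^sup>2 - z) * - (v\<^sup>2) = z * v\<^sup>2 - 1" using v2 by (simp add: algebra_simps)
  finally obtain w where "z * v\<^sup>2 = w\<^sup>2" using one_plus_multiple_is_square by blast
  moreover have "z * (y\<^sup>2 * v\<^sup>2) = (z * v\<^sup>2) * y\<^sup>2" by (simp add: mult_ac)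
  ultimately have "z * (y\<^sup>2 * v\<^sup>2) = (w * y)\<^sup>2" by (simp add: power_mult_distrib)
  then show ?thesis unfolding v2 by auto
qed

end

section \<open>Vectors and the orthogonal form in coordinates\<close>

locale orthogonal_plane = odd_galois_ring p s m \<pi>
  for p s m :: nat and \<pi> :: "'a :: {comm_ring_1, finite}" +
  fixes \<delta> :: nat and z c :: 'a
  assumes z_unit: "z dvd 1" and z_nonsquare: "\<nexists>y. z = y\<^sup>2"
    and c_cases: "c \<in> {1, z}" and \<delta>_cases: "\<delta> \<in> {0, 1, 2}"
begin

text \<open>To treat all \<open>\<delta>\<close> at once, an element of \<open>R ^ \<delta>\<close> is a pair in \<open>coords UNIV\<close>: the
  coordinates that do not exist are \<open>0\<close>.\<close>

definition coords :: "'a set \<Rightarrow> ('a \<times> 'a) set" where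
  "coords A = (if \<delta> = 0 then {0} else A) \<times> (if \<delta> = 2 then A else {0})"

text \<open>The bilinear form of \<open>\<Delta>\<close>. One formula serves all
  \<open>\<delta>\<close>, since on \<open>coords UNIV\<close> the terms of missing coordinates
  vanish.\<close>

definition bil :: "'a \<times> 'a \<Rightarrow> 'a \<times> 'a \<Rightarrow> 'a" where
  "bil x y = (if \<delta> = 1 then c else 1) * (fst x * fst y) - z * (snd x * snd y)"

text \<open>\<open>a\<close> and \<open>b\<close> are the hyperbolic coordinates and
  \<open>x\<close> is the part on which \<open>\<Delta>\<close> acts. The dimension
  \<open>2 + \<delta>\<close> cuts off the padding zeros of \<open>x\<close>.\<close>

definition mk :: "'a \<Rightarrow> 'a \<Rightarrow> 'a \<times> 'a \<Rightarrow> 'a vec" where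
  "mk a b x = vec (2 + \<delta>) (\<lambda>i. [a, b, fst x, snd x] ! i)"

definition small :: "'a \<times> 'a \<Rightarrow> bool" where
  "small x \<longleftrightarrow> \<pi> dvd fst x \<and> \<pi> dvd snd x"

lemma card_coords: "card (coords A) = card A ^ \<delta>"
  using \<delta>_cases by (auto simp: coords_def card_cartesian_product power2_eq_square)

lemma coords_multiples: "coords {a. \<pi> dvd a} = {x \<in> coords UNIV. small x}"
  by (auto simp: coords_def small_def)

lemma coords_diff: "x \<in> coords UNIV \<Longrightarrow> y \<in> coords UNIV \<Longrightarrow> x - y \<in> coords UNIV"
  and coords_scale: "x \<in> coords UNIV \<Longrightarrow> (u * fst x, u * snd x) \<in> coords UNIV"
  by (auto simp: coords_def minus_prod_def)

lemma coordsD: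
  assumes "x \<in> coords UNIV"
  shows "\<delta> = 0 \<Longrightarrow> fst x = 0" "\<delta> \<noteq> 2 \<Longrightarrow> snd x = 0"
  using assms unfolding coords_def by auto

lemma less_two_plus_iff: "i < 2 + \<delta> \<longleftrightarrow> i = 0 \<or> i = 1 \<or> i = 2 \<and> \<delta> \<noteq> 0 \<or> i = 3 \<and> \<delta> = 2"
  using \<delta>_cases by auto

lemma orth_mat_index:
  assumes "i < 2 + \<delta>" "j < 2 + \<delta>"
  shows "orth_mat z c 1 \<delta> $$ (i, j) =
    (if i < 2 then if i + j = 1 then 1 else 0
     else if i = j then if i = 2 then if \<delta> = 1 then c else 1 else - z else 0)"
  using assms \<delta>_cases unfolding orth_mat_def Delta_mat_def
  by (auto simp: mk_diagonal_def Let_def)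

lemma orth_form_mk:
  assumes "x \<in> coords UNIV" "y \<in> coords UNIV"
  shows "orth_form z c 1 \<delta> (mk a b x) (mk a' b' y) = a * b' + b * a' + bil x y"
proof -
  have d: "dim_row (orth_mat z c 1 \<delta>) = 2 + \<delta>" "dim_col (orth_mat z c 1 \<delta>) = 2 + \<delta>"
    using orth_mat_carrier[OF \<delta>_cases, of z c 1] by auto
  have "{0..<2} = {0, 1 :: nat}" "{0..<3} = {0, 1, 2 :: nat}" "{0..<4} = {0, 1, 2, 3 :: nat}"
    by auto
  then show ?thesis
    using \<delta>_cases assms d orth_mat_index
    unfolding orth_form_def mk_def bil_def coords_def
    by (elim insertE) (simp_all add: scalar_prod_def mem_Times_iff mult.left_commute)
qed

lemma mk_index:
  "mk a b x $ 0 = a" "mk a b x $ 1 = b"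
  "\<delta> \<noteq> 0 \<Longrightarrow> mk a b x $ 2 = fst x" "\<delta> = 2 \<Longrightarrow> mk a b x $ 3 = snd x"
  using \<delta>_cases unfolding mk_def by auto

lemma mk_carrier: "mk a b x \<in> carrier_vec (2 + \<delta>)"
  by (simp add: mk_def)

lemma eq_mkI:
  assumes "v \<in> carrier_vec (2 + \<delta>)" "v $ 0 = a" "v $ 1 = b"
    "\<delta> \<noteq> 0 \<Longrightarrow> v $ 2 = fst x" "\<delta> = 2 \<Longrightarrow> v $ 3 = snd x"
  shows "v = mk a b x"
proof (rule eq_vecI)
  show "dim_vec v = dim_vec (mk a b x)" using assms mk_carrier[of a b x] by simp
  show "v $ i = mk a b x $ i" if "i < dim_vec (mk a b x)" for i
  proof -
    have "i < 2 + \<delta>" using that by (simp add: mk_def)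
    then show ?thesis
      unfolding less_two_plus_iff using assms mk_index[where a = a and b = b and x = x] by auto
  qed
qed

lemma mk_inject:
  assumes "x \<in> coords UNIV" "y \<in> coords UNIV"
  shows "mk a b x = mk a' b' y \<longleftrightarrow> a = a' \<and> b = b' \<and> x = y"
proof
  assume eq: "mk a b x = mk a' b' y"
  have "fst x = fst y"
  proof (cases "\<delta> = 0")
    case False
    then show ?thesis using eq mk_index(3) by metis
  qed (use coordsD assms in auto)
  moreover have "snd x = snd y"
  proof (cases "\<delta> = 2")
    case True
    then show ?thesis using eq mk_index(4) by metis
  qed (use coordsD assms in auto)
  ultimately show "a = a' \<and> b = b' \<and> x = y"
    using eq mk_index(1,2) by (metis prod_eqI)
qed simp

lemma smult_mk: "u \<cdot>\<^sub>v mk a b x = mk (u * a) (u * b) (u * fst x, u * snd x)"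
proof (rule eq_mkI)
  show "u \<cdot>\<^sub>v mk a b x \<in> carrier_vec (2 + \<delta>)" using mk_carrier by simp
  have smult: "(u \<cdot>\<^sub>v mk a b x) $ i = u * mk a b x $ i" if "i < 2 + \<delta>" for i
    using that by (simp add: mk_def)
  show "(u \<cdot>\<^sub>v mk a b x) $ 0 = u * a" "(u \<cdot>\<^sub>v mk a b x) $ 1 = u * b"
    "\<delta> \<noteq> 0 \<Longrightarrow> (u \<cdot>\<^sub>v mk a b x) $ 2 = fst (u * fst x, u * snd x)"
    "\<delta> = 2 \<Longrightarrow> (u \<cdot>\<^sub>v mk a b x) $ 3 = snd (u * fst x, u * snd x)"
    using smult mk_index[of a b x] unfolding less_two_plus_iff by auto
qed

lemma mk_surj:
  assumes "v \<in> carrier_vec (2 + \<delta>)"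
  obtains a b x where "x \<in> coords UNIV" "v = mk a b x"
proof
  let ?x = "(if \<delta> = 0 then 0 else v $ 2, if \<delta> = 2 then v $ 3 else 0)"
  show "?x \<in> coords UNIV" by (auto simp: coords_def)
  show "v = mk (v $ 0) (v $ 1) ?x" by (rule eq_mkI) (use assms in auto)
qed

lemma mk_unit_coord:
  assumes "x \<in> coords UNIV"
  shows "mk a b x \<in> unit_coord_vecs (2 + \<delta>) \<longleftrightarrow> a dvd 1 \<or> b dvd 1 \<or> \<not> small x"
proof -
  have "mk a b x \<in> unit_coord_vecs (2 + \<delta>) \<longleftrightarrow>
      a dvd 1 \<or> b dvd 1 \<or> (\<delta> \<noteq> 0 \<and> fst x dvd 1) \<or> (\<delta> = 2 \<and> snd x dvd 1)"
    unfolding unit_coord_vecs_def less_two_plus_iff using mk_carrier mk_index[of a b x] by auto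
  \<comment> \<open>A padding entry is 0 and so never a unit; this removes the conditions on
    \<open>\<delta>\<close>.\<close>
  moreover have "fst x dvd 1 \<Longrightarrow> \<delta> \<noteq> 0" "snd x dvd 1 \<Longrightarrow> \<delta> = 2"
    using coordsD[OF assms] by (metis dvd_0_left_iff zero_neq_one)+
  ultimately show ?thesis unfolding small_def not_unit_iff[symmetric] by blast
qed

section \<open>Anisotropy of \<open>\<Delta>\<close> modulo \<open>\<pi>\<close>\<close>

lemma bil_small: "small y \<Longrightarrow> \<pi> dvd bil x y"
  by (auto simp: bil_def small_def intro!: dvd_diff dvd_mult)

text \<open>For \<open>\<delta> = 1\<close> the coefficient \<open>c\<close> is a unit and
  \<open>\<pi>\<close> is prime. For \<open>\<delta> = 2\<close>, a zero modulo \<open>\<pi>\<close>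
  with unit second entry would make \<open>z\<close> a square modulo \<open>\<pi>\<close>, hence a
  square; so the second entry is divisible by \<open>\<pi>\<close>, and then the first.\<close>

lemma anisotropic:
  assumes x: "x \<in> coords UNIV"
  shows "\<pi> dvd bil x x \<longleftrightarrow> small x"
proof
  assume *: "\<pi> dvd bil x x"
  have cu: "\<not> \<pi> dvd c" using c_cases z_unit unit_iff[of c] by auto
  show "small x"
  proof (cases "\<delta> = 2")
    case False
    then show ?thesis
      using * coordsD[OF x] \<delta>_cases cu unfolding bil_def small_def by (auto simp: \<pi>_dvd_mult_iff)
  next
    case True
    obtain a b where ab: "x = (a, b)" by fastforce
    have d: "\<pi> dvd a\<^sup>2 - z * b\<^sup>2" using * True ab unfolding bil_def by (simp add: power2_eq_square)
    have b: "\<pi> dvd b"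
    proof (rule ccontr)
      assume "\<not> \<pi> dvd b"
      then obtain v where v: "b * v = 1" using unit_iff dvdE by metis
      have v2: "b\<^sup>2 * v\<^sup>2 = 1" using v by (simp add: power_mult_distrib[symmetric])
      have "\<pi> dvd (a\<^sup>2 - z * b\<^sup>2) * v\<^sup>2" using d by (rule dvd_mult2)
      also have "(a\<^sup>2 - z * b\<^sup>2) * v\<^sup>2 = (a * v)\<^sup>2 - z * (b\<^sup>2 * v\<^sup>2)"
        by (simp add: algebra_simps power_mult_distrib)
      finally have "\<pi> dvd (a * v)\<^sup>2 - z" by (simp add: v2)
      then show False using square_of_square_mod z_unit z_nonsquare by blast
    qed
    then have "\<pi> dvd z * b\<^sup>2" by (simp add: power2_eq_square)
    with d have "\<pi> dvd (a\<^sup>2 - z * b\<^sup>2) + z * b\<^sup>2" by (rule dvd_add)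
    then have "\<pi> dvd a" by (simp add: power2_eq_square \<pi>_dvd_mult_iff)
    then show ?thesis using b ab by (simp add: small_def)
  qed
qed (rule bil_small)

section \<open>Normal forms of isotropic vectors\<close>

definition half :: 'a where "half = (SOME half. 2 * half = 1)"

lemma two_half: "2 * half = 1"
  unfolding half_def by (rule someI_ex) (metis unit_two dvdE)

text \<open>The boolean says which of the two hyperbolic coordinates is scaled to \<open>1\<close>: the first one
  for \<open>True\<close>, the second one, which is allowed only if the first is not a unit, for \<open>False\<close>.\<close>

definition idx :: "(bool \<times> 'a \<times> 'a) set" where
  "idx = {(e, x). x \<in> coords UNIV \<and> (e \<or> small x)}"

definition normal_vec :: "bool \<times> 'a \<times> 'a \<Rightarrow> 'a vec" where
  "normal_vec i = (let x = snd i; r = - half * bil x x in if fst i then mk 1 r x else mk r 1 x)"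

text \<open>Non-adjacency expressed on indices. Any two \<open>False\<close> indices in
  \<open>idx\<close> are near, since both of their vectors are small; they form a single
  part.\<close>

definition near :: "bool \<times> 'a \<times> 'a \<Rightarrow> bool \<times> 'a \<times> 'a \<Rightarrow> bool" where
  "near i j \<longleftrightarrow> fst i = fst j \<and> small (snd i - snd j)"

lemma normal_vec_isotropic:
  assumes "i \<in> idx"
  shows "normal_vec i \<in> unit_coord_vecs (2 * 1 + \<delta>)" "orth_form z c 1 \<delta> (normal_vec i) (normal_vec i) = 0"
proof -
  have x: "snd i \<in> coords UNIV" using assms by (auto simp: idx_def)
  show "normal_vec i \<in> unit_coord_vecs (2 * 1 + \<delta>)"
    using x by (simp add: normal_vec_def Let_def mk_unit_coord del: add_2_eq_Suc)
  \<comment> \<open>With hyperbolic coordinates 1 and \<open>r\<close>, the form takes the value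
    \<open>r + r + b\<close>, where \<open>b = bil x x\<close> and
    \<open>r = - half * b\<close>.\<close>
  have "- half * b + - half * b + b = 0" for b
  proof -
    have "- half * b + - half * b + b = b - (2 * half) * b" by (simp add: algebra_simps)
    then show ?thesis by (simp add: two_half)
  qed
  moreover have "orth_form z c 1 \<delta> (normal_vec i) (normal_vec i) = - half * b + - half * b + b"
    if "b = bil (snd i) (snd i)" for b
    using x that by (simp add: normal_vec_def Let_def orth_form_mk del: One_nat_def)
  ultimately show "orth_form z c 1 \<delta> (normal_vec i) (normal_vec i) = 0" by (simp only:)
qed

text \<open>Whether the first coordinate is a unit is invariant under unit factors and separates the
  two kinds: for \<open>False\<close> it is a multiple of \<open>\<pi>\<close>, as \<open>x\<close>
  is small. Within one kind, the coordinate equal to 1 forces the factor \<open>u\<close> to be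
  1.\<close>

lemma inj_vec_class_normal_vec: "inj_on (vec_class \<circ> normal_vec) idx"
proof
  fix i j assume ij: "i \<in> idx" "j \<in> idx" and eq: "(vec_class \<circ> normal_vec) i = (vec_class \<circ> normal_vec) j"
  from eq obtain u where u: "u dvd 1" "normal_vec j = u \<cdot>\<^sub>v normal_vec i" by (auto simp: vec_class_eq_iff)
  have x: "snd i \<in> coords UNIV" "snd j \<in> coords UNIV" using ij by (auto simp: idx_def)
  define r where "r k = - half * bil (snd k) (snd k)" for k :: "bool \<times> 'a \<times> 'a"
  have r: "\<not> r k dvd 1" if "k \<in> idx" "\<not> fst k" for k
    using that unfolding not_unit_iff r_def by (auto simp: idx_def intro!: dvd_mult bil_small)
  have normal_vec: "normal_vec k = (if fst k then mk 1 (r k) (snd k) else mk (r k) 1 (snd k))" for k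
    by (simp add: normal_vec_def Let_def r_def)
  note inj = u(2)[unfolded normal_vec] smult_mk mk_inject[OF x(2) coords_scale[OF x(1)]]
  consider "fst i" "fst j" | "\<not> fst i" "\<not> fst j" | "fst i" "\<not> fst j" | "\<not> fst i" "fst j"
    by blast
  then show "i = j"
  proof cases
    case 3
    then have "r j = u" using inj by simp
    then show ?thesis using r[OF ij(2)] 3 u(1) by simp
  next
    case 4
    then have "1 = u * r i" using inj by simp
    then have "r i dvd 1" by (metis dvd_triv_right)
    then show ?thesis using r[OF ij(1)] 4 by simp
  qed (use inj in \<open>auto simp: prod_eq_iff\<close>)
qed

text \<open>Each isotropic vector is scaled by the inverse \<open>v\<close> of a unit among its
  hyperbolic coordinates; isotropy determines the other one.\<close>

lemma orth_verts_eq: "orth_verts z c 1 \<delta> = (vec_class \<circ> normal_vec) ` idx"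
proof (intro equalityI subsetI)
  fix A assume "A \<in> (vec_class \<circ> normal_vec) ` idx"
  then show "A \<in> orth_verts z c 1 \<delta>" using normal_vec_isotropic unfolding orth_verts_def by fastforce
next
  fix A assume "A \<in> orth_verts z c 1 \<delta>"
  then obtain \<alpha> where \<alpha>: "A = vec_class \<alpha>" "\<alpha> \<in> unit_coord_vecs (2 + \<delta>)"
      "orth_form z c 1 \<delta> \<alpha> \<alpha> = 0" by (auto simp: orth_verts_def)
  then have "\<alpha> \<in> carrier_vec (2 + \<delta>)" by (simp add: unit_coord_vecs_def)
  then obtain a b x where x: "x \<in> coords UNIV" "\<alpha> = mk a b x" by (rule mk_surj)
  have iso: "2 * (a * b) + bil x x = 0" using \<alpha> x by (simp add: orth_form_mk mult.commute del: One_nat_def)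
  have ab: "a * b = - half * bil x x"
  proof -
    have "half * (2 * (a * b) + bil x x) = (2 * half) * (a * b) + half * bil x x" by (simp add: algebra_simps)
    then have "a * b + half * bil x x = 0" by (simp add: iso two_half)
    then show ?thesis by (simp add: eq_neg_iff_add_eq_0)
  qed
  have scale: "bil (v * fst x, v * snd x) (v * fst x, v * snd x) = v * v * bil x x" for v
    by (simp add: bil_def algebra_simps)
  have "\<exists>u e y. u dvd 1 \<and> (e, y) \<in> idx \<and> normal_vec (e, y) = u \<cdot>\<^sub>v \<alpha>"
  proof (cases "a dvd 1")
    case True
    then obtain v where v: "a * v = 1" by (metis dvdE)
    \<comment> \<open>The remaining coordinate \<open>v * b\<close> has to be the one prescribed by
      \<open>normal_vec\<close> for the scaled vector; \<open>a * v = 1\<close> gives this.\<close>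
    have "- half * (v * v * bil x x) = v * v * (a * b)" by (simp add: ab)
    also have "\<dots> = (a * v) * (v * b)" by (simp add: algebra_simps)
    finally have "normal_vec (True, v * fst x, v * snd x) = v \<cdot>\<^sub>v \<alpha>"
      using x v by (simp add: normal_vec_def smult_mk scale mult.commute)
    moreover have "(True, v * fst x, v * snd x) \<in> idx" using x coords_scale by (auto simp: idx_def)
    moreover have "v dvd 1" using v by (metis dvd_triv_right)
    ultimately show ?thesis by blast
  next
    case False
    \<comment> \<open>If \<open>a\<close> is not a unit, isotropy makes \<open>bil x x\<close>
      divisible by \<open>\<pi>\<close>. By anisotropy \<open>x\<close> is small, so only
      \<open>b\<close> can be the unit coordinate.\<close>
    then have "\<pi> dvd 2 * (a * b)" by (simp add: not_unit_iff)
    then have "\<pi> dvd bil x x" using iso by (metis dvd_0_right dvd_add_right_iff)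
    then have small: "small x" using x anisotropic by simp
    then have "b dvd 1" using \<alpha>(2) x False by (simp add: mk_unit_coord del: add_2_eq_Suc)
    then obtain v where v: "b * v = 1" by (metis dvdE)
    have "- half * (v * v * bil x x) = v * v * (a * b)" by (simp add: ab)
    also have "\<dots> = (b * v) * (v * a)" by (simp add: algebra_simps)
    finally have "normal_vec (False, v * fst x, v * snd x) = v \<cdot>\<^sub>v \<alpha>"
      using x v by (simp add: normal_vec_def smult_mk scale mult.commute)
    moreover have "(False, v * fst x, v * snd x) \<in> idx"
      using x coords_scale small by (auto simp: idx_def small_def)
    moreover have "v dvd 1" using v by (metis dvd_triv_right)
    ultimately show ?thesis by blast
  qed
  then obtain u i where i: "u dvd 1" "i \<in> idx" "normal_vec i = u \<cdot>\<^sub>v \<alpha>" by blast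
  then have "vec_class \<alpha> = vec_class (normal_vec i)" unfolding vec_class_eq_iff by blast
  then show "A \<in> (vec_class \<circ> normal_vec) ` idx" using \<alpha>(1) i(2) by simp
qed

section \<open>Adjacency of normal forms\<close>

lemma orth_form_normal_vec:
  assumes "i \<in> idx" "j \<in> idx"
  shows "orth_form z c 1 \<delta> (normal_vec i) (normal_vec j) dvd 1 \<longleftrightarrow> \<not> near i j"
proof -
  have x: "snd i \<in> coords UNIV" "snd j \<in> coords UNIV" using assms by (auto simp: idx_def)
  note form = normal_vec_def Let_def orth_form_mk[OF x]
  show ?thesis
  proof (cases "fst i = fst j")
    case True
    \<comment> \<open>Polarisation turns the pairing into \<open>- half * bil ?d ?d\<close>; as
      \<open>half\<close> is a unit, anisotropy decides whether this is one.\<close>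
    let ?d = "snd i - snd j"
    have d: "bil ?d ?d = bil (snd i) (snd i) + bil (snd j) (snd j) - 2 * bil (snd i) (snd j)"
      by (simp add: bil_def algebra_simps)
    have "- half * bil ?d ?d
        = - half * bil (snd i) (snd i) + - half * bil (snd j) (snd j) + (2 * half) * bil (snd i) (snd j)"
      unfolding d by (simp add: algebra_simps)
    then have "orth_form z c 1 \<delta> (normal_vec i) (normal_vec j) = - half * bil ?d ?d"
      using True unfolding two_half by (simp add: form del: One_nat_def)
    moreover have "\<not> \<pi> dvd half" using two_half by (metis dvd_mult unit_iff dvd_refl)
    ultimately show ?thesis
      using True x anisotropic[OF coords_diff] by (simp add: unit_iff \<pi>_dvd_mult_iff near_def)
  next
    case False
    have bil_comm: "bil (snd j) (snd i) = bil (snd i) (snd j)" by (simp add: bil_def mult.commute)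
    have s: "small (snd i) \<or> small (snd j)" using False assms by (auto simp: idx_def)
    \<comment> \<open>The hyperbolic part contributes 1 and the product of the two other
      coordinates, whose signs cancel. One of the two vectors is small, so every term of
      \<open>?w\<close> is a multiple of \<open>\<pi>\<close>.\<close>
    let ?w = "(half * bil (snd i) (snd i)) * (half * bil (snd j) (snd j)) + bil (snd i) (snd j)"
    have "orth_form z c 1 \<delta> (normal_vec i) (normal_vec j) = 1 + ?w"
      using False by (auto simp: form simp del: One_nat_def)
    moreover have "\<pi> dvd ?w"
      using s bil_small[of "snd i" "snd i"] bil_small[of "snd j" "snd j"]
        bil_small[of "snd j" "snd i"] bil_small[of "snd i" "snd j"]
      by (auto simp: \<pi>_dvd_mult_iff bil_comm intro!: dvd_add)
    ultimately have "\<not> \<pi> dvd orth_form z c 1 \<delta> (normal_vec i) (normal_vec j)"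
      using unit_iff[of 1] by (metis dvd_add_left_iff dvd_refl)
    then show ?thesis using False by (simp add: unit_iff near_def)
  qed
qed

section \<open>Counting vertices and parts\<close>

text \<open>The \<open>True\<close> indices range over all of \<open>coords UNIV\<close>, the
  \<open>False\<close> indices only over the small elements.\<close>

lemma card_idx: "card idx = (p ^ (m * \<delta>) + 1) * p ^ (m * (s - 1) * \<delta>)"
proof -
  have "idx = Pair True ` coords UNIV \<union> Pair False ` coords {a. \<pi> dvd a}"
    by (auto simp: idx_def coords_multiples)
  moreover have "Pair True ` coords UNIV \<inter> Pair False ` coords {a. \<pi> dvd a} = {}" by auto
  ultimately have "card idx = card (coords UNIV) + card (coords {a. \<pi> dvd a})"
    by (simp add: card_Un_disjoint card_image inj_on_def)
  also have "\<dots> = p ^ (s * m * \<delta>) + p ^ (m * (s - 1) * \<delta>)"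
    using galois by (simp add: card_coords card_multiples power_mult galois_ring_def)
  also have "s * m * \<delta> = m * \<delta> + m * (s - 1) * \<delta>"
    using s_pos by (cases s) (auto simp: algebra_simps)
  finally show ?thesis by (simp add: power_add)
qed

text \<open>The indices near \<open>i\<close> arise by subtracting the small elements from
  \<open>snd i\<close>. For a \<open>False\<close> index this stays inside \<open>idx\<close>,
  because \<open>snd i\<close> is small itself.\<close>

lemma card_near:
  assumes "i \<in> idx"
  shows "card {j \<in> idx. near i j} = p ^ (m * (s - 1) * \<delta>)"
proof -
  have x: "snd i \<in> coords UNIV" "fst i \<or> small (snd i)" using assms by (auto simp: idx_def)
  have "{j \<in> idx. near i j} = (\<lambda>y. (fst i, snd i - y)) ` coords {a. \<pi> dvd a}" (is "?L = ?R")
  proof (intro equalityI subsetI)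
    fix j assume "j \<in> ?L"
    then have j: "snd j \<in> coords UNIV" "fst i = fst j" "small (snd i - snd j)"
      by (auto simp: near_def idx_def)
    then have "snd i - snd j \<in> coords {a. \<pi> dvd a}"
      using coords_diff[OF x(1) j(1)] by (simp add: coords_multiples)
    moreover have "j = (fst i, snd i - (snd i - snd j))" using j by (simp add: prod_eq_iff)
    ultimately show "j \<in> ?R" by (rule rev_image_eqI)
  next
    fix j assume "j \<in> ?R"
    then obtain y where y: "j = (fst i, snd i - y)" "y \<in> coords UNIV" "small y"
      unfolding coords_multiples by blast
    have "small (snd i) \<Longrightarrow> small (snd i - y)" using y(3) by (simp add: small_def)
    moreover have "snd i - (snd i - y) = y" by (simp add: prod_eq_iff)
    ultimately show "j \<in> ?L"
      using x y coords_diff[OF x(1) y(2)] by (auto simp: near_def idx_def simp del: split_paired_All)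
  qed
  then have "card {j \<in> idx. near i j} = card (coords {a. \<pi> dvd a})"
    by (simp add: card_image inj_on_def)
  then show ?thesis by (simp add: card_coords card_multiples power_mult)
qed

lemma near_refl: "near i i"
  and near_sym: "near i j \<Longrightarrow> near j i"
  and near_trans: "near i j \<Longrightarrow> near j k \<Longrightarrow> near i k"
proof -
  show "near i i" by (simp add: near_def small_def)
  show "near j i" if "near i j"
    using that by (auto simp: near_def small_def) (metis dvd_minus_iff minus_diff_eq)+
  show "near i k" if "near i j" "near j k"
    using that dvd_add[of \<pi> "fst (snd i) - fst (snd j)" "fst (snd j) - fst (snd k)"]
      dvd_add[of \<pi> "snd (snd i) - snd (snd j)" "snd (snd j) - snd (snd k)"]
    by (auto simp: near_def small_def)
qed

section \<open>The graph and its parameters\<close>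

lemma adj_normal_vec_iff:
  assumes "i \<in> idx" "j \<in> idx"
  shows "(vec_class (normal_vec i), vec_class (normal_vec j)) \<in> parcs (orth_graph z c 1 \<delta>) \<longleftrightarrow> \<not> near i j"
  using orth_graph_adj_iff[OF \<delta>_cases normal_vec_isotropic[OF assms(1)] normal_vec_isotropic[OF assms(2)]]
    orth_form_normal_vec[OF assms] by simp

text \<open>The bijection \<open>vec_class \<circ> normal_vec\<close> transports \<open>near\<close>
  to non-adjacency. For \<open>\<delta> = 0\<close> every part is a single vertex, which is why
  \<open>\<mu>\<close> is left open there; otherwise it equals the degree.\<close>

lemma strongly_regular_orth_graph:
  assumes "\<delta> = 0 \<or> \<mu> = p ^ (m * s * \<delta>)"
  shows "strongly_regular (orth_graph z c 1 \<delta>)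
    ((p ^ (m * \<delta>) + 1) * p ^ (m * (s - 1) * \<delta>)) (p ^ (m * s * \<delta>))
    ((p ^ (m * \<delta>) - 1) * p ^ (m * (s - 1) * \<delta>)) \<mu>"
proof -
  define G where "G = orth_graph z c 1 \<delta>"
  note adj = adj_normal_vec_iff[folded G_def]
  let ?f = "vec_class \<circ> normal_vec"
  let ?t = "p ^ (m * (s - 1) * \<delta>)" and ?n = "(p ^ (m * \<delta>) + 1) * p ^ (m * (s - 1) * \<delta>)"
  have V: "pverts G = ?f ` idx" by (simp add: G_def orth_graph_def orth_verts_eq del: One_nat_def)
  \<comment> \<open>Splitting off one factor of the part size \<open>?t\<close> identifies the
    degree with \<open>?n - ?t\<close>; \<open>s \<ge> 1\<close> makes the truncated
    \<open>s - 1\<close> harmless.\<close>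
  have "m * s * \<delta> = m * \<delta> + m * (s - 1) * \<delta>"
    using s_pos by (cases s) (auto simp: algebra_simps)
  then have k: "p ^ (m * s * \<delta>) = ?n - ?t" by (simp add: power_add)
  have l: "(p ^ (m * \<delta>) - 1) * ?t = ?n - 2 * ?t" by (simp add: algebra_simps)
  show ?thesis
    unfolding k l G_def[symmetric]
  proof (rule strongly_regular_complete_multipartite)
    show "finite (pverts G)" by (simp add: V)
    show "parcs G \<subseteq> pverts G \<times> pverts G" by (auto simp: G_def orth_graph_def)
    show "equiv (pverts G) (pverts G \<times> pverts G - parcs G)"
    proof (rule equivI)
      show "refl_on (pverts G) (pverts G \<times> pverts G - parcs G)"
        by (auto simp: V refl_on_def adj near_refl)
      show "sym (pverts G \<times> pverts G - parcs G)"
        by (auto simp: V sym_def adj intro: near_sym)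
      show "trans (pverts G \<times> pverts G - parcs G)"
        by (auto simp: V trans_def adj intro: near_trans)
    qed auto
    show "card (pverts G) = ?n" using card_image[OF inj_vec_class_normal_vec] by (simp add: V card_idx)
    show "card {y \<in> pverts G. (x, y) \<notin> parcs G} = ?t" if x: "x \<in> pverts G" for x
    proof -
      obtain i where i: "i \<in> idx" "x = ?f i" using x unfolding V by blast
      have "{y \<in> pverts G. (x, y) \<notin> parcs G} = ?f ` {j \<in> idx. near i j}"
        using i by (auto simp: V adj)
      moreover have "inj_on ?f {j \<in> idx. near i j}"
        by (rule inj_on_subset[OF inj_vec_class_normal_vec]) auto
      ultimately show ?thesis using card_near[OF i(1)] by (simp only: card_image)
    qed
    show "?t = 1 \<or> \<mu> = ?n - ?t" using assms k by auto
  qed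
qed

end

theorem theorem3p3:
  fixes p s m \<delta> :: nat
    and z c :: "'a :: {comm_ring_1, finite}"
  assumes "prime p" and "odd p" and "s \<ge> 2" and "m \<ge> 1"
    and "galois_ring TYPE('a) p s m"
    and "z dvd 1" and "\<nexists>y. z = y\<^sup>2"
    and "c \<in> {1, z}"
    and "\<delta> \<in> {0, 1, 2}"
  shows "strongly_regular (orth_graph z c 1 \<delta>)
           ((p ^ (m * \<delta>) + 1) * p ^ (m * (s - 1) * \<delta>))
           (p ^ (m * s * \<delta>))
           ((p ^ (m * \<delta>) - 1) * p ^ (m * \<delta> * (s - 1)))
           (nat \<lceil>real \<delta> / 2\<rceil> * p ^ (m * s * \<delta>)) \<and>
         (real p ^ m - 1) * (real p ^ (m * \<delta>) + 1) * real p ^ (m * (s - 1) * \<delta>) / (real p ^ m - 1)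
           = real ((p ^ (m * \<delta>) + 1) * p ^ (m * (s - 1) * \<delta>))"
proof
  interpret orthogonal_plane p s m "of_nat p" \<delta> z c
    using assms by unfold_locales auto
  have "\<lceil>1 / 2 :: real\<rceil> = 1" by (simp add: ceiling_eq_iff)
  \<comment> \<open>The ceiling is 1 for \<open>\<delta> = 1\<close> and
    \<open>\<delta> = 2\<close>, so \<open>\<mu>\<close> is the degree; for
    \<open>\<delta> = 0\<close> the claim about \<open>\<mu>\<close> is vacuous.\<close>
  then have ceil: "\<delta> = 0 \<or> nat \<lceil>real \<delta> / 2\<rceil> = 1" using assms(9) by auto
  have comm: "m * \<delta> * (s - 1) = m * (s - 1) * \<delta>" by (simp add: mult_ac)
  show "strongly_regular (orth_graph z c 1 \<delta>)
           ((p ^ (m * \<delta>) + 1) * p ^ (m * (s - 1) * \<delta>))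
           (p ^ (m * s * \<delta>))
           ((p ^ (m * \<delta>) - 1) * p ^ (m * \<delta> * (s - 1)))
           (nat \<lceil>real \<delta> / 2\<rceil> * p ^ (m * s * \<delta>))"
    unfolding comm using ceil by (intro strongly_regular_orth_graph) auto
  \<comment> \<open>The denominator is nonzero because \<open>m \<ge> 1\<close>, so the common
    factor cancels.\<close>
  have "real p ^ m > 1"
    using assms(4) prime_gt_1_nat[OF assms(1)] by (intro one_less_power) auto
  then show "(real p ^ m - 1) * (real p ^ (m * \<delta>) + 1) * real p ^ (m * (s - 1) * \<delta>) / (real p ^ m - 1)
           = real ((p ^ (m * \<delta>) + 1) * p ^ (m * (s - 1) * \<delta>))"
    by (simp add: distrib_right)
qed

end
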